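(* There exist irreducible almost upper-triangular transition matrices $U$ on $\mathbb N$ with several (at least two) positive, non-proportional right eigenvectors associated with the eigenvalue $1$.
   Context: $\mathbb N=\{0,1,2,\dots\}$. A transition matrix $U=[U_{i,j}]_{i,j\ge0}$ on $\mathbb N$ (non-negative entries, rows summing to $1$) is almost upper-triangular if $U_{i,j}>0\Rightarrow j\ge i-1$. A right eigenvector for the eigenvalue $1$ is a non-zero column vector $R=(R_i)_{i\ge0}$ with $\sum_jU_{i,j}R_j=R_i$ for all $i$; it is positive if all its entries are positive. *)

theory Defs
  imports Complex_Main
begin

type_synonym inf_matrix = "nat \<Rightarrow> nat \<Rightarrow> real"

definition transition_matrix :: "inf_matrix \<Rightarrow> bool" where
  "transition_matrix U \<longleftrightarrow> (\<forall>i j. 0 \<le> U i j) \<and> (\<forall>i. (\<lambda>j. U i j) sums 1)"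

text \<open>The condition \<open>j \<ge> i - 1\<close> is written without truncated subtraction.\<close>

definition almost_upper_triangular :: "inf_matrix \<Rightarrow> bool" where
  "almost_upper_triangular U \<longleftrightarrow> (\<forall>i j. U i j > 0 \<longrightarrow> i \<le> j + 1)"

text \<open>Matrix powers. For a transition matrix all powers are again transition
  matrices, so the series below converge and \<open>mat_pow U n i j\<close> is the
  probability of being in \<open>j\<close> after \<open>n\<close> steps from \<open>i\<close>.\<close>

primrec mat_pow :: "inf_matrix \<Rightarrow> nat \<Rightarrow> inf_matrix" where
  "mat_pow U 0 = (\<lambda>i j. if i = j then 1 else 0)"
| "mat_pow U (Suc n) = (\<lambda>i j. \<Sum>k. U i k * mat_pow U n k j)"

definition irreducible_matrix :: "inf_matrix \<Rightarrow> bool" where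
  "irreducible_matrix U \<longleftrightarrow> (\<forall>i j. \<exists>n. mat_pow U n i j > 0)"

text \<open>The predicate \<open>sums\<close> makes convergence of every row series part of the
  definition.\<close>

definition right_eigenvector :: "inf_matrix \<Rightarrow> real \<Rightarrow> (nat \<Rightarrow> real) \<Rightarrow> bool" where
  "right_eigenvector U l R \<longleftrightarrow>
     (\<exists>i. R i \<noteq> 0) \<and> (\<forall>i. (\<lambda>j. U i j * R j) sums (l * R i))"

definition positive_vector :: "(nat \<Rightarrow> real) \<Rightarrow> bool" where
  "positive_vector R \<longleftrightarrow> (\<forall>i. R i > 0)"

text \<open>Used for non-zero vectors only, for which this relation is symmetric.\<close>

definition proportional :: "(nat \<Rightarrow> real) \<Rightarrow> (nat \<Rightarrow> real) \<Rightarrow> bool" where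
  "proportional R S \<longleftrightarrow> (\<exists>c. \<forall>i. S i = c * R i)"

end

theory Submission
  imports Defs
begin

text \<open>
  The constant vector \<open>1\<close> is a right eigenvector of every transition matrix for the eigenvalue \<open>1\<close>,
  so it is enough to find a chain with a non-constant positive harmonic function. Such a function
  exists when the chain can escape to infinity in two distinguishable ways. This can happen even
  though the chain descends by at most one at a time, because upward jumps by \<open>2\<close> preserve
  parity: if from \<open>i\<close> the only moves are \<open>i \<rightarrow> i - 1\<close> (\<open>0 \<rightarrow> 1\<close> at the boundary) and
  \<open>i \<rightarrow> i + 2\<close>, and the probabilities of the former are summable over \<open>i\<close>, then the chain can
  settle on the even or on the odd numbers.

  No escape probabilities have to be computed, since the construction can be run backwards.
  Prescribe the values \<open>S\<close>, and let \<open>i\<close> go to only two states, its neighbour of the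
  other parity and \<open>i + 2\<close>. If \<open>S i\<close> lies strictly between the values at these two states,
  then it is a convex combination of them with positive weights, and these weights define the row
  \<open>i\<close> (\<open>ratio_weight_between\<close>, \<open>ratio_weight_mean\<close>). The values \<open>2 - 1 / (i + 1)\<close> at even
  \<open>i\<close> and \<open>1 / (i + 1)\<close> at odd \<open>i\<close> satisfy the betweenness condition
  (\<open>parity_harmonic_between\<close>). Irreducibility holds for all positive weights: jumping by \<open>2\<close>
  overtakes any target, and single steps then descend to it (\<open>irreducible_two_step_matrix\<close>).
\<close>

text \<open>The state \<open>0\<close> has no predecessor, so it uses \<open>1\<close> as its neighbour of odd parity.\<close>

definition opposite_neighbour :: "nat \<Rightarrow> nat" where
  "opposite_neighbour i = (if i = 0 then 1 else i - 1)"

definition two_step_matrix :: "(nat \<Rightarrow> real) \<Rightarrow> inf_matrix" where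
  "two_step_matrix a i j =
     (if j = opposite_neighbour i then a i else if j = i + 2 then 1 - a i else 0)"

lemma opposite_neighbour_neq: "opposite_neighbour i \<noteq> i + 2"
  by (auto simp: opposite_neighbour_def)

lemma two_step_matrix_sums:
  "(\<lambda>j. two_step_matrix a i j * f j) sums
     (a i * f (opposite_neighbour i) + (1 - a i) * f (i + 2))"
proof -
  have "(\<lambda>j. two_step_matrix a i j * f j) sums
      (\<Sum>j\<in>{opposite_neighbour i, i + 2}. two_step_matrix a i j * f j)"
    by (rule sums_finite) (auto simp: two_step_matrix_def)
  then show ?thesis
    using opposite_neighbour_neq[of i] by (simp add: two_step_matrix_def)
qed

lemma transition_matrix_two_step_matrix:
  assumes "\<And>i. 0 \<le> a i" "\<And>i. a i \<le> 1"
  shows "transition_matrix (two_step_matrix a)"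
  using assms two_step_matrix_sums[of a _ "\<lambda>_. 1"]
  by (auto simp: transition_matrix_def two_step_matrix_def)

lemma almost_upper_triangular_two_step_matrix:
  "almost_upper_triangular (two_step_matrix a)"
  by (auto simp: almost_upper_triangular_def two_step_matrix_def opposite_neighbour_def)

lemma mat_pow_two_step_matrix_Suc:
  "mat_pow (two_step_matrix a) (Suc n) i j =
     a i * mat_pow (two_step_matrix a) n (opposite_neighbour i) j +
     (1 - a i) * mat_pow (two_step_matrix a) n (i + 2) j"
  using sums_unique[OF two_step_matrix_sums[of a i "\<lambda>k. mat_pow (two_step_matrix a) n k j"]]
  by simp

lemma mat_pow_two_step_matrix_nonneg:
  assumes "\<And>i. 0 \<le> a i" "\<And>i. a i \<le> 1"
  shows "0 \<le> mat_pow (two_step_matrix a) n i j"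
proof (induction n arbitrary: i)
  case 0
  show ?case by simp
next
  case (Suc n)
  then show ?case
    using assms by (simp add: mat_pow_two_step_matrix_Suc del: mat_pow.simps(2))
qed

text \<open>The target is fixed and the start varies. From below the target, jumps by \<open>2\<close> reduce the
  distance until they reach or overshoot it; from above, single steps down cannot miss it.\<close>

lemma irreducible_two_step_matrix:
  assumes pos: "\<And>i. 0 < a i" and less: "\<And>i. a i < 1"
  shows "irreducible_matrix (two_step_matrix a)"
proof -
  let ?P = "mat_pow (two_step_matrix a)"
  have nonneg: "0 \<le> ?P n i j" for n i j
    using pos less by (intro mat_pow_two_step_matrix_nonneg) (auto intro: less_imp_le)
  have via_neighbour: "0 < ?P (Suc n) i j" if "0 < ?P n (opposite_neighbour i) j" for n i j
    unfolding mat_pow_two_step_matrix_Suc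
    using that nonneg[of n "i + 2" j] pos[of i] less[of i]
    by (intro add_pos_nonneg mult_pos_pos mult_nonneg_nonneg) auto
  have via_jump: "0 < ?P (Suc n) i j" if "0 < ?P n (i + 2) j" for n i j
    unfolding mat_pow_two_step_matrix_Suc
    using that nonneg[of n "opposite_neighbour i" j] pos[of i] less[of i]
    by (intro add_nonneg_pos mult_pos_pos mult_nonneg_nonneg) auto
  have above: "\<exists>n. 0 < ?P n (j + m) j" for j m
  proof (induction m)
    case 0
    have "0 < ?P 0 j j" by simp
    then show ?case by (metis add_0_right)
  next
    case (Suc m)
    then obtain n where "0 < ?P n (j + m) j" by blast
    then have "0 < ?P (Suc n) (j + Suc m) j"
      by (intro via_neighbour) (simp add: opposite_neighbour_def)
    then show ?case by blast
  qed
  have "\<exists>n. 0 < ?P n i j" for i j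
  proof (induction "j - i" arbitrary: i rule: less_induct)
    case less
    show ?case
    proof (cases "j \<le> i")
      case True
      then show ?thesis using above[of j "i - j"] by simp
    next
      case False
      then have "j - (i + 2) < j - i" by simp
      then obtain n where "0 < ?P n (i + 2) j" using less by blast
      then show ?thesis using via_jump by blast
    qed
  qed
  then show ?thesis by (simp add: irreducible_matrix_def)
qed

text \<open>The weight of \<open>x\<close> in the representation of \<open>s\<close> as a convex combination of \<open>x\<close> and \<open>y\<close>.\<close>

definition ratio_weight :: "real \<Rightarrow> real \<Rightarrow> real \<Rightarrow> real" where
  "ratio_weight s x y = (y - s) / (y - x)"

lemma ratio_weight_between:
  assumes "x < s \<and> s < y \<or> y < s \<and> s < x"
  shows "0 < ratio_weight s x y" "ratio_weight s x y < 1"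
  using assms by (auto simp: ratio_weight_def field_simps)

lemma ratio_weight_mean:
  assumes "x \<noteq> y"
  shows "ratio_weight s x y * x + (1 - ratio_weight s x y) * y = s"
proof -
  have "ratio_weight s x y * (y - x) = y - s"
    using assms by (simp add: ratio_weight_def)
  then show ?thesis by (simp add: algebra_simps)
qed

text \<open>The values increase to \<open>2\<close> along the even numbers and decrease to \<open>0\<close> along the odd ones, and
  \<open>1\<close> separates the two parities. For the chain built from them, this is twice the probability
  of being eventually even.\<close>

definition parity_harmonic :: "nat \<Rightarrow> real" where
  "parity_harmonic i = (if even i then 2 - 1 / (real i + 1) else 1 / (real i + 1))"

lemma parity_harmonic_pos: "0 < parity_harmonic i"
  by (simp add: parity_harmonic_def field_simps)

lemma parity_harmonic_even: "even i \<Longrightarrow> 1 \<le> parity_harmonic i"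
  by (simp add: parity_harmonic_def)

lemma parity_harmonic_odd: "odd i \<Longrightarrow> parity_harmonic i < 1"
  by (auto simp: parity_harmonic_def elim: oddE)

lemma even_opposite_neighbour: "even (opposite_neighbour i) \<longleftrightarrow> odd i"
  by (cases i) (auto simp: opposite_neighbour_def)

lemma parity_harmonic_between:
  "parity_harmonic (opposite_neighbour i) < parity_harmonic i \<and>
     parity_harmonic i < parity_harmonic (i + 2) \<or>
   parity_harmonic (i + 2) < parity_harmonic i \<and>
     parity_harmonic i < parity_harmonic (opposite_neighbour i)"
proof (cases "even i")
  case True
  then have "parity_harmonic (opposite_neighbour i) < parity_harmonic i"
    using parity_harmonic_odd[of "opposite_neighbour i"] parity_harmonic_even[of i]
    by (simp add: even_opposite_neighbour)
  moreover have "parity_harmonic i < parity_harmonic (i + 2)"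
    using True by (simp add: parity_harmonic_def field_simps)
  ultimately show ?thesis by blast
next
  case False
  then have "parity_harmonic i < parity_harmonic (opposite_neighbour i)"
    using parity_harmonic_even[of "opposite_neighbour i"] parity_harmonic_odd[of i]
    by (simp add: even_opposite_neighbour)
  moreover have "parity_harmonic (i + 2) < parity_harmonic i"
    using False by (simp add: parity_harmonic_def field_simps)
  ultimately show ?thesis by blast
qed

theorem proposition2p10:
  "\<exists>U. transition_matrix U \<and> irreducible_matrix U \<and> almost_upper_triangular U \<and>
     (\<exists>R S. right_eigenvector U 1 R \<and> positive_vector R \<and>
            right_eigenvector U 1 S \<and> positive_vector S \<and>
            \<not> proportional R S)"
proof -
  let ?S = parity_harmonic
  define a where "a i = ratio_weight (?S i) (?S (opposite_neighbour i)) (?S (i + 2))" for i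
  let ?U = "two_step_matrix a"
  have a: "0 < a i" "a i < 1" for i
    unfolding a_def by (rule ratio_weight_between[OF parity_harmonic_between])+
  have trans: "transition_matrix ?U"
    using a by (intro transition_matrix_two_step_matrix) (auto intro: less_imp_le)
  then have "right_eigenvector ?U 1 (\<lambda>_. 1)"
    by (simp add: right_eigenvector_def transition_matrix_def)
  moreover have "right_eigenvector ?U 1 ?S"
  proof -
    have "(\<lambda>j. ?U i j * ?S j) sums ?S i" for i
    proof -
      have "?S (opposite_neighbour i) \<noteq> ?S (i + 2)"
        using parity_harmonic_between[of i] by linarith
      then have "a i * ?S (opposite_neighbour i) + (1 - a i) * ?S (i + 2) = ?S i"
        unfolding a_def by (rule ratio_weight_mean)
      then show ?thesis using two_step_matrix_sums[of a i ?S] by simp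
    qed
    moreover have "?S 0 \<noteq> 0" by (simp add: parity_harmonic_def)
    ultimately show ?thesis by (auto simp: right_eigenvector_def)
  qed
  moreover have "\<not> proportional (\<lambda>_. 1) ?S"
  proof
    assume "proportional (\<lambda>_. 1) ?S"
    then have "?S 0 = ?S 1" by (auto simp: proportional_def)
    then show False by (simp add: parity_harmonic_def)
  qed
  moreover have "positive_vector (\<lambda>_. 1)" "positive_vector ?S"
    by (simp_all add: positive_vector_def parity_harmonic_pos)
  ultimately show ?thesis
    using trans irreducible_two_step_matrix[of a, OF a] almost_upper_triangular_two_step_matrix
    by blast
qed

end
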